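(* Let $p,q>0$, and let $\mathcal{N}$ be a (finite or infinite) network for the Bass model such that $p_j=p$ and $q_j=q$ for all $j\in\mathcal{M}$, where $q_j=\sum_{k\in\mathcal{M}}q_{k,j}$. Then $$f_m(t;\mathcal{N})\ge f_{M=2}^{\rm hom}(t;p,q),\qquad t\ge 0,\quad m\in\mathcal{M},$$ and so $$f(t;\mathcal{N})\ge f_{M=2}^{\rm hom}(t;p,q),\qquad t\ge 0.$$
   Context: Bass model on a network. Let $\mathcal{M}=\{1,\dots,M\}$ be a set of individuals (nodes), where $M$ may be finite or infinite (if $M=\infty$, $\mathcal{M}=\{1,2,\dots\}$). $X_j(t)\in\{0,1\}$ is the state of $j$ at continuous time $t\ge 0$ ($1$ = adopter, $0$ = nonadopter), with $X_j(0)=0$ for all $j$. Each node $j$ has an external influence rate $p_j>0$, and each ordered pair $(k,j)$ has an internal influence rate $q_{k,j}\ge 0$ of $k$ on $j$, with $q_{k,j}>0$ iff there is a directed edge from $k$ to $j$, and $q_{j,j}=0$; symmetry $q_{k,j}=q_{j,k}$ is not assumed. Adopters remain adopters forever, and a nonadopter $j$ adopts at rate $\lambda_j(t)=p_j+\sum_{k\in\mathcal{M}}q_{k,j}X_k(t)$; i.e. as $\Delta t\to 0$, $\mathbb{P}(X_j(t+\Delta t)=1\mid \mathbf{X}(t))$ equals $1$ if $X_j(t)=1$ and $\big(p_j+\sum_{k\in\mathcal{M}}q_{k,j}X_k(t)\big)\Delta t$ if $X_j(t)=0$, where $\mathbf{X}(t)=(X_1(t),\dots,X_M(t))$. Set $q_j:=\sum_{k\in\mathcal{M}}q_{k,j}$;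 it is assumed that $q_j>0$ for all $j$. The network need not be connected. The network is denoted $\mathcal{N}=\mathcal{N}(\mathcal{M},\{p_k\},\{q_{k,j}\})$. Adoption probability of node $j$: $f_j(t;\mathcal{N}):=\mathbb{P}(X_j(t)=1)$. Expected adoption level: $f(t;\mathcal{N}):=\frac1M\sum_{j=1}^M f_j(t;\mathcal{N})$ if $M<\infty$, and $f(t;\mathcal{N}):=\lim_{M\to\infty}\frac1M\sum_{j=1}^M f_j(t;\mathcal{N})$ for infinite networks. Two-node network: $\mathcal{N}_{M=2}^{\rm hom}(p,q)$ is the network with $\mathcal{M}=\{1,2\}$, $p_1=p_2=p$, $q_{1,2}=q_{2,1}=q$, $q_{1,1}=q_{2,2}=0$, and $f_{M=2}^{\rm hom}(t;p,q)$ is the expected adoption level on it, which is given explicitly by $f_{M=2}^{\rm hom}(t;p,q)=1-e^{-pt}\dfrac{qe^{-pt}-pe^{-qt}}{q-p}$ for $p\ne q$. *)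

theory Defs
  imports "HOL-Probability.Probability"
begin

definition nodes :: "enat \<Rightarrow> nat set" where
  "nodes M = {j. 1 \<le> j \<and> enat j \<le> M}"

definition internal_rate :: "enat \<Rightarrow> (nat \<Rightarrow> nat \<Rightarrow> real) \<Rightarrow> nat \<Rightarrow> real" where
  "internal_rate M q j = (\<Sum>\<^sub>\<infinity>k\<in>nodes M. q k j)"

text \<open>Here \<open>q k j\<close> is the influence of \<open>k\<close> on \<open>j\<close>. Summability is part of the meaning of
  the column sum being a real number; \<^const>\<open>infsum\<close> would otherwise default to zero.
  Values of \<open>p\<close> and \<open>q\<close> outside \<open>nodes M\<close> are irrelevant.\<close>

locale bass_network =
  fixes M :: enat and p :: "nat \<Rightarrow> real" and q :: "nat \<Rightarrow> nat \<Rightarrow> real"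
  assumes nodes_nonempty: "1 \<le> M"
    and p_pos: "\<And>j. j \<in> nodes M \<Longrightarrow> 0 < p j"
    and q_nonneg: "\<And>k j. k \<in> nodes M \<Longrightarrow> j \<in> nodes M \<Longrightarrow> 0 \<le> q k j"
    and q_diag: "\<And>j. j \<in> nodes M \<Longrightarrow> q j j = 0"
    and q_summable: "\<And>j. j \<in> nodes M \<Longrightarrow> (\<lambda>k. q k j) summable_on nodes M"
    and internal_rate_pos: "\<And>j. j \<in> nodes M \<Longrightarrow> 0 < internal_rate M q j"

definition adoption_rate ::
  "enat \<Rightarrow> (nat \<Rightarrow> real) \<Rightarrow> (nat \<Rightarrow> nat \<Rightarrow> real) \<Rightarrow> (nat \<Rightarrow> real \<Rightarrow> 'a \<Rightarrow> real)
    \<Rightarrow> nat \<Rightarrow> real \<Rightarrow> 'a \<Rightarrow> real" where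
  "adoption_rate M p q X j t \<omega> = p j + (\<Sum>\<^sub>\<infinity>k\<in>nodes M. q k j * X k t \<omega>)"

definition state_algebra ::
  "enat \<Rightarrow> 'a measure \<Rightarrow> (nat \<Rightarrow> real \<Rightarrow> 'a \<Rightarrow> real) \<Rightarrow> real \<Rightarrow> 'a measure" where
  "state_algebra M P X t =
    vimage_algebra (space P) (\<lambda>\<omega>. \<lambda>k\<in>nodes M. X k t \<omega>) (\<Pi>\<^sub>M k\<in>nodes M. borel)"

definition state_cond_prob ::
  "enat \<Rightarrow> 'a measure \<Rightarrow> (nat \<Rightarrow> real \<Rightarrow> 'a \<Rightarrow> real) \<Rightarrow> real \<Rightarrow> 'a set \<Rightarrow> 'a \<Rightarrow> real" where
  "state_cond_prob M P X t A = real_cond_exp P (state_algebra M P X t) (indicator A)"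

text \<open>The infinitesimal description of the transition probabilities given the whole state at
  time \<open>t\<close> is read with an error \<open>o(h)\<close>, \<open>h > 0\<close>, that may depend on the nodes but is uniform in
  \<open>t\<close> and in the state. Uniformity in \<open>t\<close> reflects time-homogeneity: an error term
  depending on \<open>t\<close> would allow additional adoptions with positive probability at fixed times.
  Distinct nodes adopt in separate events, so two simultaneous adoptions have
  conditional probability \<open>o(h)\<close>; the marginal rates alone do not imply this.\<close>

locale bass_process = bass_network M p q
  for M :: enat and p :: "nat \<Rightarrow> real" and q :: "nat \<Rightarrow> nat \<Rightarrow> real" +
  fixes P :: "'a measure" and X :: "nat \<Rightarrow> real \<Rightarrow> 'a \<Rightarrow> real"
  assumes prob_space: "prob_space P"
    and X_measurable: "\<And>j t. j \<in> nodes M \<Longrightarrow> 0 \<le> t \<Longrightarrow> X j t \<in> borel_measurable P"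
    and X_states: "\<And>j t \<omega>. j \<in> nodes M \<Longrightarrow> 0 \<le> t \<Longrightarrow> \<omega> \<in> space P \<Longrightarrow> X j t \<omega> \<in> {0, 1}"
    and X_initial: "\<And>j \<omega>. j \<in> nodes M \<Longrightarrow> \<omega> \<in> space P \<Longrightarrow> X j 0 \<omega> = 0"
    and X_absorbing: "\<And>j s t \<omega>. j \<in> nodes M \<Longrightarrow> 0 \<le> s \<Longrightarrow> s \<le> t \<Longrightarrow> \<omega> \<in> space P \<Longrightarrow>
          X j s \<omega> = 1 \<Longrightarrow> X j t \<omega> = 1"
    and adoption: "\<And>j \<epsilon>. j \<in> nodes M \<Longrightarrow> 0 < \<epsilon> \<Longrightarrow>
          \<exists>\<delta>>0. \<forall>t\<ge>0. \<forall>h. 0 < h \<and> h < \<delta> \<longrightarrow>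
            (AE \<omega> in P.
              \<bar>state_cond_prob M P X t {\<omega>' \<in> space P. X j (t + h) \<omega>' = 1} \<omega>
                - (if X j t \<omega> = 1 then 1 else adoption_rate M p q X j t \<omega> * h)\<bar> \<le> \<epsilon> * h)"
    and no_simultaneous: "\<And>j k \<epsilon>. j \<in> nodes M \<Longrightarrow> k \<in> nodes M \<Longrightarrow> j \<noteq> k \<Longrightarrow> 0 < \<epsilon> \<Longrightarrow>
          \<exists>\<delta>>0. \<forall>t\<ge>0. \<forall>h. 0 < h \<and> h < \<delta> \<longrightarrow>
            (AE \<omega> in P. X j t \<omega> = 0 \<and> X k t \<omega> = 0 \<longrightarrow>
              state_cond_prob M P X t
                {\<omega>' \<in> space P. X j (t + h) \<omega>' = 1 \<and> X k (t + h) \<omega>' = 1} \<omega> \<le> \<epsilon> * h)"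

definition adoption_prob ::
  "'a measure \<Rightarrow> (nat \<Rightarrow> real \<Rightarrow> 'a \<Rightarrow> real) \<Rightarrow> nat \<Rightarrow> real \<Rightarrow> real" where
  "adoption_prob P X j t = measure P {\<omega> \<in> space P. X j t \<omega> = 1}"

definition mean_adoption ::
  "'a measure \<Rightarrow> (nat \<Rightarrow> real \<Rightarrow> 'a \<Rightarrow> real) \<Rightarrow> real \<Rightarrow> nat \<Rightarrow> real" where
  "mean_adoption P X t n = (\<Sum>j=1..n. adoption_prob P X j t) / real n"

definition adoption_level ::
  "enat \<Rightarrow> 'a measure \<Rightarrow> (nat \<Rightarrow> real \<Rightarrow> 'a \<Rightarrow> real) \<Rightarrow> real \<Rightarrow> real" where
  "adoption_level M P X t =
    (case M of enat n \<Rightarrow> mean_adoption P X t n | \<infinity> \<Rightarrow> lim (mean_adoption P X t))"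

text \<open>For an infinite network the Cesaro limit need not exist, and \<^const>\<open>lim\<close> is then
  meaningless.\<close>

definition adoption_level_exists ::
  "enat \<Rightarrow> 'a measure \<Rightarrow> (nat \<Rightarrow> real \<Rightarrow> 'a \<Rightarrow> real) \<Rightarrow> real \<Rightarrow> bool" where
  "adoption_level_exists M P X t \<longleftrightarrow> (M = \<infinity> \<longrightarrow> convergent (mean_adoption P X t))"

definition two_node_process ::
  "real \<Rightarrow> real \<Rightarrow> 'a measure \<Rightarrow> (nat \<Rightarrow> real \<Rightarrow> 'a \<Rightarrow> real) \<Rightarrow> bool" where
  "two_node_process p q P X \<longleftrightarrow>
    bass_process 2 (\<lambda>j. p) (\<lambda>k j. if k = j then 0 else q) P X"

end

theory Submission
  imports Defs
begin

text \<open>Write \<open>S\<^sub>A(t)\<close> for the probability that no node of \<open>A\<close> has adopted by time \<open>t\<close>. For single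
  nodes and pairs of an arbitrary network these probabilities satisfy

  \<open>S\<^sub>m' = -(p\<^sub>m + q\<^sub>m) S\<^sub>m + \<Sum>\<^sub>k q\<^bsub>k,m\<^esub> S\<^bsub>{m,k}\<^esub>\<close> and \<open>S\<^bsub>{j,k}\<^esub>' \<le> -(p\<^sub>j + p\<^sub>k) S\<^bsub>{j,k}\<^esub>\<close>.

  The inequality drops the internal influence on the pair, which can only speed up adoption. On the
  two-node network nobody is left to influence the pair \<open>{1,2}\<close>, so there it is an equality. Hence
  the pair is idle with at least as large a probability on two nodes as any pair is on the given
  network, and as \<open>\<Sum>\<^sub>k q\<^bsub>k,m\<^esub> = q\<close> the source term in the equation for a single node is largest on two
  nodes as well. Comparing the two single-node equations gives the claim: among networks with the
  same rates \<open>p\<close> and \<open>q\<close>, the two-node network is the most likely to keep a node idle.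

  The process is given by its transition probabilities over short times, so derivatives are
  replaced by increments with an error \<open>\<epsilon> h\<close> that is uniform in \<open>t\<close>; the comparison principle
  \<open>le_of_increment_bounds\<close> needs neither differentiability nor the explicit
  solution on two nodes. Its hypotheses come from \<open>idle_pair_increment_le\<close> and
  \<open>idle_single_increment_le\<close> on the given network, and from \<open>idle_pair_increment_ge\<close> and
  \<open>idle_single_increment_ge\<close> on two nodes.\<close>

section \<open>Comparison of linear differential inequalities in increment form\<close>

text \<open>A Gronwall argument by Euler steps: with \<open>h = t / n\<close> the hypothesis propagates
  \<open>w (i h) \<le> \<epsilon> i h\<close> from \<open>i\<close> to \<open>i + 1\<close>, since \<open>0 \<le> 1 - c h \<le> 1\<close> for small \<open>h\<close>; at \<open>i = n\<close> this
  reads \<open>w t \<le> \<epsilon> t\<close>. Only the values on the grid enter, so \<open>w\<close> may be discontinuous, but the step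
  size for a given \<open>\<epsilon>\<close> has to serve all times at once.\<close>
lemma nonpos_of_increment_bound:
  fixes w :: "real \<Rightarrow> real"
  assumes init: "w 0 \<le> 0" and c: "0 \<le> c"
    and step: "\<And>\<epsilon>. 0 < \<epsilon> \<Longrightarrow>
      \<forall>\<^sub>F h in at_right 0. \<forall>t\<ge>0. w (t + h) \<le> (1 - c * h) * w t + \<epsilon> * h"
    and t: "0 \<le> t"
  shows "w t \<le> 0"
proof (rule field_le_epsilon)
  fix e :: real assume e: "0 < e"
  define \<epsilon> where "\<epsilon> = e / (t + 1)"
  have eps: "0 < \<epsilon>" "\<epsilon> * t \<le> e" using e t by (auto simp: \<epsilon>_def field_simps)
  obtain \<delta> where \<delta>: "0 < \<delta>"
    and d: "\<And>s h. 0 \<le> s \<Longrightarrow> 0 < h \<Longrightarrow> h < \<delta> \<Longrightarrow> w (s + h) \<le> (1 - c * h) * w s + \<epsilon> * h"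
    using step[OF eps(1)] unfolding eventually_at_right_field by blast
  show "w t \<le> 0 + e"
  proof (cases "t = 0")
    case True
    then show ?thesis using init e by simp
  next
    case False
    \<comment> \<open>The second bound on the step size makes \<open>c * h < 1\<close>.\<close>
    define \<eta> where "\<eta> = min \<delta> (1 / (c + 1))"
    have "0 < \<eta>" using \<delta> c by (simp add: \<eta>_def)
    obtain n where n: "t / \<eta> < real n" using reals_Archimedean2 by blast
    have n0: "0 < real n" using n t \<open>0 < \<eta>\<close> by (smt (verit) divide_nonneg_pos)
    define h where "h = t / real n"
    have h: "0 < h" "h < \<eta>" using n n0 t False \<open>0 < \<eta>\<close> by (auto simp: h_def field_simps)
    have h\<delta>: "h < \<delta>" using h by (simp add: \<eta>_def)
    have "h < 1 / (c + 1)" using h by (simp add: \<eta>_def)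
    then have "h * (c + 1) < 1" using c by (simp add: pos_less_divide_eq)
    then have ch: "0 \<le> 1 - c * h" "1 - c * h \<le> 1" using h c by (auto simp: algebra_simps)
    have "w (real i * h) \<le> \<epsilon> * (real i * h)" for i
    proof (induction i)
      case 0
      then show ?case using init by simp
    next
      case (Suc i)
      have "w (real i * h + h) \<le> (1 - c * h) * w (real i * h) + \<epsilon> * h"
        using h h\<delta> by (intro d) auto
      also have "\<dots> \<le> (1 - c * h) * (\<epsilon> * (real i * h)) + \<epsilon> * h"
        using mult_left_mono[OF Suc.IH ch(1)] by simp
      also have "\<dots> \<le> 1 * (\<epsilon> * (real i * h)) + \<epsilon> * h"
        using ch eps h by (intro add_right_mono mult_right_mono) auto
      finally show ?case by (simp add: algebra_simps)
    qed
    from this[of n] show ?thesis using n0 eps by (simp add: h_def)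
  qed
qed

text \<open>In the limit, \<open>u' \<le> -c u + g\<close> and \<open>v' \<ge> -c v + g\<close>: the source \<open>g\<close> cancels from the difference
  \<open>u - v\<close>.\<close>
lemma le_of_increment_bounds:
  fixes u v g :: "real \<Rightarrow> real"
  assumes init: "u 0 \<le> v 0" and c: "0 \<le> c"
    and u: "\<And>\<epsilon>. 0 < \<epsilon> \<Longrightarrow>
      \<forall>\<^sub>F h in at_right 0. \<forall>t\<ge>0. u (t + h) \<le> (1 - c * h) * u t + h * g t + \<epsilon> * h"
    and v: "\<And>\<epsilon>. 0 < \<epsilon> \<Longrightarrow>
      \<forall>\<^sub>F h in at_right 0. \<forall>t\<ge>0. (1 - c * h) * v t + h * g t - \<epsilon> * h \<le> v (t + h)"
    and t: "0 \<le> t"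
  shows "u t \<le> v t"
proof -
  have "u t - v t \<le> 0"
  proof (rule nonpos_of_increment_bound[where w = "\<lambda>t. u t - v t" and c = c])
    fix \<epsilon> :: real assume "0 < \<epsilon>"
    then have e2: "0 < \<epsilon> / 2" by simp
    show "\<forall>\<^sub>F h in at_right 0. \<forall>t\<ge>0.
        u (t + h) - v (t + h) \<le> (1 - c * h) * (u t - v t) + \<epsilon> * h"
      using u[OF e2] v[OF e2]
    proof eventually_elim
      case (elim h)
      show ?case
      proof (intro allI impI)
        fix t :: real assume t: "0 \<le> t"
        show "u (t + h) - v (t + h) \<le> (1 - c * h) * (u t - v t) + \<epsilon> * h"
          using elim(1)[rule_format, OF t] elim(2)[rule_format, OF t] by (simp add: algebra_simps)
      qed
    qed
  qed (use init c t in auto)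
  then show ?thesis by simp
qed

section \<open>Events determined by the state\<close>

lemma (in prob_space) prob_Int_eq_integral_cond_prob:
  assumes F: "subalgebra M F" and B: "B \<in> sets F" and A: "A \<in> sets M"
  shows "integrable M (\<lambda>x. indicator B x * real_cond_exp M F (indicator A) x)"
    and "prob (B \<inter> A) = (\<integral>x. indicator B x * real_cond_exp M F (indicator A) x \<partial>M)"
proof -
  interpret finite_measure_subalgebra M F by unfold_locales (rule F)
  have BM: "B \<in> sets M" using F B by (auto simp: subalgebra_def)
  have eq: "(\<lambda>x. indicator B x * indicator A x :: real) = indicator (B \<inter> A)"
    by (auto simp: indicator_def fun_eq_iff)
  have int: "integrable M (\<lambda>x. indicator B x * indicator A x :: real)"
    unfolding eq using A BM by (intro integrable_real_indicator) (auto simp: emeasure_eq_measure)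
  show "integrable M (\<lambda>x. indicator B x * real_cond_exp M F (indicator A) x)"
    using int A B by (intro real_cond_exp_intg) auto
  have "(\<integral>x. indicator B x * real_cond_exp M F (indicator A) x \<partial>M)
      = (\<integral>x. indicator B x * indicator A x \<partial>M)"
    using int A B by (intro real_cond_exp_intg) auto
  also have "\<dots> = prob (B \<inter> A)"
    unfolding eq using A BM by simp
  finally show "prob (B \<inter> A) = (\<integral>x. indicator B x * real_cond_exp M F (indicator A) x \<partial>M)" ..
qed

definition idle :: "'a measure \<Rightarrow> (nat \<Rightarrow> real \<Rightarrow> 'a \<Rightarrow> real) \<Rightarrow> nat set \<Rightarrow> real \<Rightarrow> 'a set" where
  "idle P X A t = {\<omega> \<in> space P. \<forall>k\<in>A. X k t \<omega> = 0}"

context bass_process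
begin

lemma subalgebra_state:
  assumes t: "0 \<le> t"
  shows "subalgebra P (state_algebra M P X t)"
proof -
  have m: "(\<lambda>\<omega>. \<lambda>k\<in>nodes M. X k t \<omega>) \<in> P \<rightarrow>\<^sub>M (\<Pi>\<^sub>M k\<in>nodes M. borel)"
    using X_measurable t by (intro measurable_restrict) auto
  show ?thesis
    unfolding subalgebra_def state_algebra_def
    using measurable_sets[OF m] measurable_space[OF m]
    by (auto simp: sets_vimage_algebra2)
qed

lemma state_event:
  assumes "0 \<le> t" and "j \<in> nodes M"
  shows "{\<omega> \<in> space P. X j t \<omega> = c} \<in> sets (state_algebra M P X t)"
proof -
  have m: "(\<lambda>\<omega>. \<lambda>k\<in>nodes M. X k t \<omega>) \<in> P \<rightarrow>\<^sub>M (\<Pi>\<^sub>M k\<in>nodes M. borel)"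
    using X_measurable assms by (intro measurable_restrict) auto
  let ?C = "{x \<in> space (\<Pi>\<^sub>M k\<in>nodes M. (borel :: real measure)). x j = c}"
  have "?C \<in> sets (\<Pi>\<^sub>M k\<in>nodes M. borel)"
    using assms by measurable
  then have "(\<lambda>\<omega>. \<lambda>k\<in>nodes M. X k t \<omega>) -` ?C \<inter> space P \<in> sets (state_algebra M P X t)"
    unfolding state_algebra_def by (rule in_vimage_algebra)
  moreover have "(\<lambda>\<omega>. \<lambda>k\<in>nodes M. X k t \<omega>) -` ?C \<inter> space P = {\<omega> \<in> space P. X j t \<omega> = c}"
    using assms measurable_space[OF m] by auto
  ultimately show ?thesis by simp
qed

lemma event_measurable:
  "0 \<le> t \<Longrightarrow> j \<in> nodes M \<Longrightarrow> {\<omega> \<in> space P. X j t \<omega> = c} \<in> sets P"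
  using state_event subalgebra_state unfolding subalgebra_def by blast

lemma idle_insert:
  "idle P X (insert j A) t = {\<omega> \<in> space P. X j t \<omega> = 0} \<inter> idle P X A t"
  by (auto simp: idle_def)

lemma idle_in_state:
  assumes t: "0 \<le> t" and "finite A" "A \<subseteq> nodes M"
  shows "idle P X A t \<in> sets (state_algebra M P X t)"
  using assms(2,3)
proof (induction A rule: finite_induct)
  case empty
  have "space (state_algebra M P X t) \<in> sets (state_algebra M P X t)" by (rule sets.top)
  moreover have "space (state_algebra M P X t) = space P"
    using subalgebra_state[OF t] by (simp add: subalgebra_def)
  ultimately show ?case by (simp add: idle_def)
next
  case (insert j A)
  then show ?case
    unfolding idle_insert using state_event[OF t] by (intro sets.Int) auto
qed

lemma idle_measurable:
  "0 \<le> t \<Longrightarrow> finite A \<Longrightarrow> A \<subseteq> nodes M \<Longrightarrow> idle P X A t \<in> sets P"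
  using idle_in_state subalgebra_state unfolding subalgebra_def by blast

lemma adopted_iff:
  "0 \<le> t \<Longrightarrow> j \<in> nodes M \<Longrightarrow> \<omega> \<in> space P \<Longrightarrow> X j t \<omega> = 1 \<longleftrightarrow> X j t \<omega> \<noteq> 0"
  using X_states by fastforce

lemma idle_antimono_time:
  assumes "0 \<le> s" "s \<le> t" "A \<subseteq> nodes M"
  shows "idle P X A t \<subseteq> idle P X A s"
  using assms X_states X_absorbing unfolding idle_def by fastforce

lemma idle_initial:
  assumes "A \<subseteq> nodes M"
  shows "idle P X A 0 = space P"
  using assms X_initial unfolding idle_def by fastforce

text \<open>As adoption is irreversible, an idle set is lost exactly when one of its nodes adopts within
  the step.\<close>
lemma idle_step:
  assumes "0 \<le> t" "0 \<le> h" "finite A" "A \<subseteq> nodes M"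
  shows "measure P (idle P X A (t + h)) = measure P (idle P X A t)
    - measure P (idle P X A t \<inter> (\<Union>j\<in>A. {\<omega> \<in> space P. X j (t + h) \<omega> = 1}))"
proof -
  interpret P: prob_space P by (rule prob_space)
  let ?U = "\<Union>j\<in>A. {\<omega> \<in> space P. X j (t + h) \<omega> = 1}"
  have adopted: "X j (t + h) \<omega> = 1 \<longleftrightarrow> X j (t + h) \<omega> \<noteq> 0" if "j \<in> A" "\<omega> \<in> space P" for j \<omega>
    using that assms by (intro adopted_iff) auto
  have "idle P X A (t + h) \<subseteq> idle P X A t"
    using assms by (intro idle_antimono_time) auto
  then have "idle P X A (t + h) = idle P X A t - (idle P X A t \<inter> ?U)"
    using adopted by (auto simp: idle_def)
  moreover have "?U \<in> sets P"
    using assms event_measurable[of "t + h"] by (intro sets.finite_UN) auto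
  then have "measure P (idle P X A t - (idle P X A t \<inter> ?U))
      = measure P (idle P X A t) - measure P (idle P X A t \<inter> ?U)"
    using assms idle_measurable[of t A] by (intro P.finite_measure_Diff) auto
  ultimately show ?thesis by simp
qed

lemma adoption_prob_eq:
  assumes "0 \<le> t" "j \<in> nodes M"
  shows "adoption_prob P X j t = 1 - measure P (idle P X {j} t)"
proof -
  interpret P: prob_space P by (rule prob_space)
  have "{\<omega> \<in> space P. X j t \<omega> = 1} = space P - idle P X {j} t"
    using assms adopted_iff[of t j] by (auto simp: idle_def)
  then show ?thesis
    unfolding adoption_prob_def
    using P.prob_compl[of "idle P X {j} t"] assms idle_measurable[of t "{j}"] by simp
qed

section \<open>Adoption over a short time step\<close>

text \<open>Truncating the internal influence to finitely many nodes bounds the adoption rate from below, and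
  the expectation of the truncated rate is a finite sum; this is how infinite networks are handled.\<close>
lemma adoption_rate_ge_finite:
  assumes "0 \<le> t" "j \<in> nodes M" "\<omega> \<in> space P" "finite F" "F \<subseteq> nodes M"
  shows "p j + (\<Sum>k\<in>F. q k j * X k t \<omega>) \<le> adoption_rate M p q X j t \<omega>"
proof -
  have X01: "0 \<le> X k t \<omega> \<and> X k t \<omega> \<le> 1" if "k \<in> nodes M" for k
    using X_states[OF that assms(1,3)] by auto
  have "(\<lambda>k. q k j * X k t \<omega>) summable_on nodes M"
    using q_summable[OF assms(2)]
    by (rule summable_on_comparison_test) (use X01 q_nonneg assms in \<open>auto intro: mult_left_le\<close>)
  then have "(\<Sum>k\<in>F. q k j * X k t \<omega>) \<le> (\<Sum>\<^sub>\<infinity>k\<in>nodes M. q k j * X k t \<omega>)"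
    using assms X01 q_nonneg by (intro finite_sum_le_infsum) auto
  then show ?thesis by (simp add: adoption_rate_def)
qed

text \<open>The offset \<open>b\<close> holds the error \<open>\<plusminus>\<epsilon> h\<close> of the conditional adoption probability.\<close>
lemma integral_finite_rate:
  assumes t: "0 \<le> t" and F: "F \<subseteq> nodes M" and B: "B \<in> sets P"
  shows "integrable P (\<lambda>\<omega>. indicator B \<omega> * ((a + (\<Sum>k\<in>F. q k j * X k t \<omega>)) * h + b))"
    and "(\<integral>\<omega>. indicator B \<omega> * ((a + (\<Sum>k\<in>F. q k j * X k t \<omega>)) * h + b) \<partial>P)
      = h * (a * measure P B
          + (\<Sum>k\<in>F. q k j * measure P (B \<inter> {\<omega> \<in> space P. X k t \<omega> = 1})))
        + b * measure P B"
proof -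
  interpret P: prob_space P by (rule prob_space)
  let ?A = "\<lambda>k. B \<inter> {\<omega> \<in> space P. X k t \<omega> = 1}"
  have A: "?A k \<in> sets P" if "k \<in> F" for k
    using event_measurable[OF t, of k 1] that F B by auto
  let ?f = "\<lambda>\<omega>. (a * h + b) * indicator B \<omega> + (\<Sum>k\<in>F. h * q k j * indicator (?A k) \<omega>)"
  have eq: "indicator B \<omega> * ((a + (\<Sum>k\<in>F. q k j * X k t \<omega>)) * h + b) = ?f \<omega>"
    if w: "\<omega> \<in> space P" for \<omega>
  proof (cases "\<omega> \<in> B")
    case True
    have ind: "indicator (?A k) \<omega> = X k t \<omega>" if "k \<in> F" for k
      using X_states[of k t \<omega>] that F t w True by (auto simp: indicator_def)
    have sum: "(\<Sum>k\<in>F. h * q k j * indicator (?A k) \<omega>) = (\<Sum>k\<in>F. q k j * X k t \<omega>) * h"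
      unfolding sum_distrib_right by (intro sum.cong refl) (simp only: ind mult_ac)
    show ?thesis unfolding sum using True by (simp add: distrib_right)
  qed auto
  have int: "integrable P (indicator S :: 'a \<Rightarrow> real)" if "S \<in> sets P" for S
    using that by (simp add: P.emeasure_eq_measure)
  have intf: "integrable P ?f"
    using int A B by (intro Bochner_Integration.integrable_add
        Bochner_Integration.integrable_sum integrable_mult_right) auto
  show "integrable P (\<lambda>\<omega>. indicator B \<omega> * ((a + (\<Sum>k\<in>F. q k j * X k t \<omega>)) * h + b))"
    using intf by (subst Bochner_Integration.integrable_cong[OF refl eq]) auto
  have "(\<integral>\<omega>. indicator B \<omega> * ((a + (\<Sum>k\<in>F. q k j * X k t \<omega>)) * h + b) \<partial>P) = (\<integral>\<omega>. ?f \<omega> \<partial>P)"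
    by (intro Bochner_Integration.integral_cong refl eq)
  also have "\<dots> = (\<integral>\<omega>. (a * h + b) * indicator B \<omega> \<partial>P)
      + (\<Sum>k\<in>F. \<integral>\<omega>. h * q k j * indicator (?A k) \<omega> \<partial>P)"
    using int A B by (subst Bochner_Integration.integral_add,
        auto intro!: Bochner_Integration.integrable_sum integrable_mult_right
          Bochner_Integration.integral_sum)
  also have "\<dots> = (a * h + b) * measure P B + (\<Sum>k\<in>F. h * q k j * measure P (?A k))"
    using A B by (simp add: Int_absorb2 sets.sets_into_space)
  finally show "(\<integral>\<omega>. indicator B \<omega> * ((a + (\<Sum>k\<in>F. q k j * X k t \<omega>)) * h + b) \<partial>P)
      = h * (a * measure P B
          + (\<Sum>k\<in>F. q k j * measure P (B \<inter> {\<omega> \<in> space P. X k t \<omega> = 1})))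
        + b * measure P B"
    by (simp add: algebra_simps sum_distrib_left)
qed

lemma conditional_adoption:
  assumes "j \<in> nodes M" and "0 < \<epsilon>"
  shows "\<forall>\<^sub>F h in at_right 0. \<forall>t\<ge>0. AE \<omega> in P.
    \<bar>state_cond_prob M P X t {\<omega>' \<in> space P. X j (t + h) \<omega>' = 1} \<omega>
      - (if X j t \<omega> = 1 then 1 else adoption_rate M p q X j t \<omega> * h)\<bar> \<le> \<epsilon> * h"
  using adoption[OF assms] unfolding eventually_at_right_field by blast

lemma conditional_joint_adoption:
  assumes "j \<in> nodes M" "k \<in> nodes M" "j \<noteq> k" and "0 < \<epsilon>"
  shows "\<forall>\<^sub>F h in at_right 0. \<forall>t\<ge>0. AE \<omega> in P. X j t \<omega> = 0 \<and> X k t \<omega> = 0 \<longrightarrow>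
    state_cond_prob M P X t {\<omega>' \<in> space P. X j (t + h) \<omega>' = 1 \<and> X k (t + h) \<omega>' = 1} \<omega> \<le> \<epsilon> * h"
  using no_simultaneous[OF assms] unfolding eventually_at_right_field by blast

text \<open>The conditional adoption probability is integrated over the event that \<open>A\<close> is idle, which
  is determined by the state at time \<open>t\<close>. On it \<open>j\<close> has not adopted, so the transition probability
  is the adoption rate times \<open>h\<close>, up to \<open>\<epsilon> h\<close>. The summand for \<open>k\<close> is the influence that \<open>k\<close> exerts
  on \<open>j\<close> once it has adopted.\<close>
lemma adoption_increment_ge:
  assumes A: "finite A" "A \<subseteq> nodes M" and j: "j \<in> A"
    and F: "finite F" "F \<subseteq> nodes M" and e: "0 < \<epsilon>"
  shows "\<forall>\<^sub>F h in at_right 0. \<forall>t\<ge>0.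
    h * (p j * measure P (idle P X A t)
        + (\<Sum>k\<in>F. q k j * measure P (idle P X A t \<inter> {\<omega> \<in> space P. X k t \<omega> = 1}))) - \<epsilon> * h
      \<le> measure P (idle P X A t \<inter> {\<omega> \<in> space P. X j (t + h) \<omega> = 1})"
proof -
  interpret P: prob_space P by (rule prob_space)
  have jM: "j \<in> nodes M" using A j by auto
  show ?thesis
    using conditional_adoption[OF jM e] eventually_at_right_less
  proof eventually_elim
    case (elim h)
    show ?case
    proof (intro allI impI)
      fix t :: real assume t: "0 \<le> t"
      let ?B = "idle P X A t" and ?E = "{\<omega> \<in> space P. X j (t + h) \<omega> = 1}"
      have E: "?E \<in> sets P" using event_measurable t elim(2) jM by simp
      note B = idle_in_state[OF t A] and BP = idle_measurable[OF t A]
      note cp = P.prob_Int_eq_integral_cond_prob[OF subalgebra_state[OF t] B E]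
      note rate = integral_finite_rate[OF t F(2) BP, where a = "p j" and b = "- (\<epsilon> * h)" and h = h]
      have "(\<integral>\<omega>. indicator ?B \<omega> * ((p j + (\<Sum>k\<in>F. q k j * X k t \<omega>)) * h + - (\<epsilon> * h)) \<partial>P)
          \<le> measure P (?B \<inter> ?E)"
        unfolding cp(2)
      proof (rule integral_mono_AE[OF rate(1) cp(1)])
        show "AE \<omega> in P. indicator ?B \<omega> * ((p j + (\<Sum>k\<in>F. q k j * X k t \<omega>)) * h + - (\<epsilon> * h))
            \<le> indicator ?B \<omega> * real_cond_exp P (state_algebra M P X t) (indicator ?E) \<omega>"
          using elim(1)[rule_format, OF t] AE_space
        proof eventually_elim
          case (elim \<omega>)
          show ?case
          proof (cases "\<omega> \<in> ?B")
            case True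
            then have "X j t \<omega> = 0" using j by (auto simp: idle_def)
            moreover have "(p j + (\<Sum>k\<in>F. q k j * X k t \<omega>)) * h \<le> adoption_rate M p q X j t \<omega> * h"
              using adoption_rate_ge_finite[OF t jM elim(2) F] \<open>0 < h\<close>
              by (intro mult_right_mono) auto
            ultimately show ?thesis using elim(1) True by (simp add: state_cond_prob_def)
          qed simp
        qed
      qed
      moreover have "\<epsilon> * h * measure P ?B \<le> \<epsilon> * h * 1"
        using e elim(2) by (intro mult_left_mono) auto
      ultimately show "h * (p j * measure P ?B
          + (\<Sum>k\<in>F. q k j * measure P (?B \<inter> {\<omega> \<in> space P. X k t \<omega> = 1}))) - \<epsilon> * h
        \<le> measure P (?B \<inter> ?E)"
        unfolding rate(2) by simp
    qed
  qed
qed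

lemma adoption_increment_le:
  assumes fin: "finite (nodes M)" and A: "A \<subseteq> nodes M" and j: "j \<in> A" and e: "0 < \<epsilon>"
  shows "\<forall>\<^sub>F h in at_right 0. \<forall>t\<ge>0.
    measure P (idle P X A t \<inter> {\<omega> \<in> space P. X j (t + h) \<omega> = 1})
      \<le> h * (p j * measure P (idle P X A t)
        + (\<Sum>k\<in>nodes M. q k j * measure P (idle P X A t \<inter> {\<omega> \<in> space P. X k t \<omega> = 1})))
        + \<epsilon> * h"
proof -
  interpret P: prob_space P by (rule prob_space)
  have jM: "j \<in> nodes M" and finA: "finite A" using A j fin finite_subset by auto
  show ?thesis
    using conditional_adoption[OF jM e] eventually_at_right_less
  proof eventually_elim
    case (elim h)
    show ?case
    proof (intro allI impI)
      fix t :: real assume t: "0 \<le> t"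
      let ?B = "idle P X A t" and ?E = "{\<omega> \<in> space P. X j (t + h) \<omega> = 1}"
      have E: "?E \<in> sets P" using event_measurable t elim(2) jM by simp
      note B = idle_in_state[OF t finA A] and BP = idle_measurable[OF t finA A]
      note cp = P.prob_Int_eq_integral_cond_prob[OF subalgebra_state[OF t] B E]
      note rate = integral_finite_rate[OF t order_refl BP, where a = "p j" and b = "\<epsilon> * h" and h = h]
      have "measure P (?B \<inter> ?E)
          \<le> (\<integral>\<omega>. indicator ?B \<omega> * ((p j + (\<Sum>k\<in>nodes M. q k j * X k t \<omega>)) * h + \<epsilon> * h) \<partial>P)"
        unfolding cp(2)
      proof (rule integral_mono_AE[OF cp(1) rate(1)])
        show "AE \<omega> in P. indicator ?B \<omega> * real_cond_exp P (state_algebra M P X t) (indicator ?E) \<omega>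
            \<le> indicator ?B \<omega> * ((p j + (\<Sum>k\<in>nodes M. q k j * X k t \<omega>)) * h + \<epsilon> * h)"
          using elim(1)[rule_format, OF t]
        proof eventually_elim
          case (elim \<omega>)
          show ?case
          proof (cases "\<omega> \<in> ?B")
            case True
            then have "X j t \<omega> = 0" using j by (auto simp: idle_def)
            then show ?thesis using elim True fin
              by (simp add: state_cond_prob_def adoption_rate_def)
          qed simp
        qed
      qed
      moreover have "\<epsilon> * h * measure P ?B \<le> \<epsilon> * h * 1"
        using e elim(2) by (intro mult_left_mono) auto
      ultimately show "measure P (?B \<inter> ?E) \<le> h * (p j * measure P ?B
          + (\<Sum>k\<in>nodes M. q k j * measure P (?B \<inter> {\<omega> \<in> space P. X k t \<omega> = 1}))) + \<epsilon> * h"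
        unfolding rate(2) by simp
    qed
  qed
qed

text \<open>This makes the inclusion-exclusion correction negligible when the adoptions of two nodes are
  counted separately.\<close>
lemma joint_adoption_increment_le:
  assumes j: "j \<in> nodes M" "k \<in> nodes M" "j \<noteq> k" and e: "0 < \<epsilon>"
  shows "\<forall>\<^sub>F h in at_right 0. \<forall>t\<ge>0.
    measure P (idle P X {j, k} t \<inter>
      {\<omega> \<in> space P. X j (t + h) \<omega> = 1 \<and> X k (t + h) \<omega> = 1}) \<le> \<epsilon> * h"
proof -
  interpret P: prob_space P by (rule prob_space)
  show ?thesis
    using conditional_joint_adoption[OF j e] eventually_at_right_less
  proof eventually_elim
    case (elim h)
    show ?case
    proof (intro allI impI)
      fix t :: real assume t: "0 \<le> t"
      let ?B = "idle P X {j, k} t"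
      let ?E = "{\<omega> \<in> space P. X j (t + h) \<omega> = 1 \<and> X k (t + h) \<omega> = 1}"
      have "?E = {\<omega> \<in> space P. X j (t + h) \<omega> = 1} \<inter> {\<omega> \<in> space P. X k (t + h) \<omega> = 1}"
        by auto
      then have E: "?E \<in> sets P" using event_measurable[of "t + h"] t elim(2) j by auto
      have B: "?B \<in> sets (state_algebra M P X t)" using t j by (intro idle_in_state) auto
      note cp = P.prob_Int_eq_integral_cond_prob[OF subalgebra_state[OF t] B E]
      have "measure P (?B \<inter> ?E) \<le> (\<integral>\<omega>. \<epsilon> * h \<partial>P)"
        unfolding cp(2)
      proof (rule integral_mono_AE[OF cp(1)])
        show "AE \<omega> in P. indicator ?B \<omega> * real_cond_exp P (state_algebra M P X t) (indicator ?E) \<omega>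
            \<le> \<epsilon> * h"
          using elim(1)[rule_format, OF t]
        proof eventually_elim
          case (elim \<omega>)
          then show ?case using e \<open>0 < h\<close>
            by (cases "\<omega> \<in> ?B") (auto simp: state_cond_prob_def idle_def)
        qed
      qed simp
      then show "measure P (?B \<inter> ?E) \<le> \<epsilon> * h" by (simp add: P.prob_space)
    qed
  qed
qed

text \<open>Each node of the pair adopts at least at its external rate, whatever the rest of the network
  does. Taking the empty set of influencing nodes in \<open>adoption_increment_ge\<close> expresses
  this.\<close>
lemma idle_pair_increment_le:
  assumes j: "j \<in> nodes M" "k \<in> nodes M" "j \<noteq> k" and e: "0 < \<epsilon>"
  shows "\<forall>\<^sub>F h in at_right 0. \<forall>t\<ge>0.
    measure P (idle P X {j, k} (t + h))
      \<le> (1 - (p j + p k) * h) * measure P (idle P X {j, k} t) + \<epsilon> * h"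
proof -
  interpret P: prob_space P by (rule prob_space)
  have e3: "0 < \<epsilon> / 3" using e by simp
  have A: "finite {j, k}" "{j, k} \<subseteq> nodes M" "j \<in> {j, k}" "k \<in> {j, k}" using j by auto
  show ?thesis
    using adoption_increment_ge[OF A(1-3) finite.emptyI empty_subsetI e3]
      adoption_increment_ge[OF A(1,2,4) finite.emptyI empty_subsetI e3]
      joint_adoption_increment_le[OF j e3] eventually_at_right_less
  proof eventually_elim
    case (elim h)
    show ?case
    proof (intro allI impI)
      fix t :: real assume t: "0 \<le> t"
      let ?B = "idle P X {j, k} t"
      let ?E = "\<lambda>i. {\<omega> \<in> space P. X i (t + h) \<omega> = 1}"
      have B: "?B \<in> sets P" using t j by (intro idle_measurable) auto
      have E: "?E j \<in> sets P" "?E k \<in> sets P"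
        using event_measurable[of "t + h"] t elim(4) j by auto
      have "measure P (idle P X {j, k} (t + h)) = measure P ?B - measure P (?B \<inter> (\<Union>i\<in>{j, k}. ?E i))"
        using t elim(4) j by (intro idle_step) auto
      moreover have "?B \<inter> (\<Union>i\<in>{j, k}. ?E i) = (?B \<inter> ?E j) \<union> (?B \<inter> ?E k)" by auto
      moreover have "measure P ((?B \<inter> ?E j) \<union> (?B \<inter> ?E k))
          = measure P (?B \<inter> ?E j) + measure P (?B \<inter> ?E k) - measure P ((?B \<inter> ?E j) \<inter> (?B \<inter> ?E k))"
        using E B by (intro measure_Un3) (auto simp: P.fmeasurable_eq_sets)
      moreover have "(?B \<inter> ?E j) \<inter> (?B \<inter> ?E k)
          = ?B \<inter> {\<omega> \<in> space P. X j (t + h) \<omega> = 1 \<and> X k (t + h) \<omega> = 1}" by auto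
      ultimately show "measure P (idle P X {j, k} (t + h))
          \<le> (1 - (p j + p k) * h) * measure P (idle P X {j, k} t) + \<epsilon> * h"
        using elim(1)[rule_format, OF t] elim(2)[rule_format, OF t] elim(3)[rule_format, OF t]
        by (simp add: algebra_simps)
    qed
  qed
qed

lemma idle_single_diff:
  assumes t: "0 \<le> t" and j: "j \<in> nodes M" "k \<in> nodes M"
  shows "measure P (idle P X {j} t \<inter> {\<omega> \<in> space P. X k t \<omega> = 1})
    = measure P (idle P X {j} t) - measure P (idle P X {j, k} t)"
proof -
  interpret P: prob_space P by (rule prob_space)
  have sub: "idle P X {j, k} t \<subseteq> idle P X {j} t" by (auto simp: idle_def)
  have "idle P X {j} t \<inter> {\<omega> \<in> space P. X k t \<omega> = 1} = idle P X {j} t - idle P X {j, k} t"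
    using adopted_iff[OF t j(2)] by (auto simp: idle_def)
  then show ?thesis
    using P.finite_measure_Diff[OF _ _ sub] idle_measurable[OF t] j by simp
qed

text \<open>A single node \<open>m\<close> adopts at rate \<open>p\<^sub>m\<close> plus the influence of each \<open>k\<close> that has adopted while
  \<open>m\<close> has not, an event of probability \<open>S\<^sub>m - S\<^bsub>{m,k}\<^esub>\<close>. A common bound \<open>s\<close> on all pair
  probabilities therefore bounds the total influence from below by \<open>q\<^sub>m (S\<^sub>m - s)\<close>.\<close>
lemma idle_single_increment_le:
  assumes m: "m \<in> nodes M" and e: "0 < \<epsilon>"
    and pair: "\<And>k t. k \<in> nodes M \<Longrightarrow> k \<noteq> m \<Longrightarrow> 0 \<le> t \<Longrightarrow> measure P (idle P X {m, k} t) \<le> s t"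
    and s: "\<And>t. 0 \<le> t \<Longrightarrow> 0 \<le> s t"
  shows "\<forall>\<^sub>F h in at_right 0. \<forall>t\<ge>0.
    measure P (idle P X {m} (t + h))
      \<le> (1 - (p m + internal_rate M q m) * h) * measure P (idle P X {m} t)
        + internal_rate M q m * h * s t + \<epsilon> * h"
proof -
  interpret P: prob_space P by (rule prob_space)
  have e2: "0 < \<epsilon> / 2" using e by simp
  \<comment> \<open>Half of the error pays for the truncation of the column sum, half for the transition probability.\<close>
  obtain F where F: "finite F" "F \<subseteq> nodes M"
    and approx: "dist (\<Sum>k\<in>F. q k m) (internal_rate M q m) \<le> \<epsilon> / 2"
    using infsum_finite_approximation[OF q_summable[OF m] e2] unfolding internal_rate_def by blast
  have F1: "internal_rate M q m - \<epsilon> / 2 \<le> (\<Sum>k\<in>F. q k m)"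
    using approx unfolding dist_real_def by linarith
  have F2: "(\<Sum>k\<in>F. q k m) \<le> internal_rate M q m"
    unfolding internal_rate_def using F q_summable[OF m] q_nonneg m
    by (intro finite_sum_le_infsum) auto
  have M: "finite {m}" "{m} \<subseteq> nodes M" "m \<in> {m}" using m by auto
  show ?thesis
    using adoption_increment_ge[OF M F e2] eventually_at_right_less
  proof eventually_elim
    case (elim h)
    show ?case
    proof (intro allI impI)
      fix t :: real assume t: "0 \<le> t"
      let ?B = "idle P X {m} t"
      let ?S = "measure P ?B" and ?Q = "internal_rate M q m"
      \<comment> \<open>The difference \<open>?S - s t\<close> may be negative, so its two parts are compared separately: \<open>?S\<close>
        with the lower and \<open>s t\<close> with the upper bound on the partial sum.\<close>
      have "?Q * ?S - \<epsilon> / 2 - ?Q * s t \<le> (\<Sum>k\<in>F. q k m) * ?S - (\<Sum>k\<in>F. q k m) * s t"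
      proof -
        have "(?Q - \<epsilon> / 2) * ?S \<le> (\<Sum>k\<in>F. q k m) * ?S"
          using F1 by (intro mult_right_mono) auto
        moreover have "(\<Sum>k\<in>F. q k m) * s t \<le> ?Q * s t"
          using F2 s[OF t] by (intro mult_right_mono) auto
        moreover have "\<epsilon> / 2 * ?S \<le> \<epsilon> / 2 * 1" using e by (intro mult_left_mono) auto
        ultimately show ?thesis by (simp add: algebra_simps)
      qed
      also have "\<dots> = (\<Sum>k\<in>F. q k m * (?S - s t))"
        by (simp add: sum_distrib_right sum_subtractf right_diff_distrib)
      also have "\<dots> \<le> (\<Sum>k\<in>F. q k m * measure P (?B \<inter> {\<omega> \<in> space P. X k t \<omega> = 1}))"
      proof (rule sum_mono)
        fix k assume k: "k \<in> F"
        show "q k m * (?S - s t) \<le> q k m * measure P (?B \<inter> {\<omega> \<in> space P. X k t \<omega> = 1})"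
        proof (cases "k = m")
          case False
          then show ?thesis
            using k F m t pair[of k t] q_nonneg[of k m] idle_single_diff[OF t m, of k]
            by (intro mult_left_mono) auto
        qed (simp add: q_diag m)
      qed
      finally have "h * (p m * ?S + (?Q * ?S - \<epsilon> / 2 - ?Q * s t)) - \<epsilon> / 2 * h
          \<le> h * (p m * ?S + (\<Sum>k\<in>F. q k m * measure P (?B \<inter> {\<omega> \<in> space P. X k t \<omega> = 1})))
            - \<epsilon> / 2 * h"
        using elim(2) by (intro diff_right_mono mult_left_mono add_left_mono) auto
      also have "\<dots> \<le> measure P (?B \<inter> {\<omega> \<in> space P. X m (t + h) \<omega> = 1})"
        using elim(1) t by blast
      finally show "measure P (idle P X {m} (t + h))
          \<le> (1 - (p m + ?Q) * h) * ?S + ?Q * h * s t + \<epsilon> * h"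
        using idle_step[of t h "{m}"] t elim(2) m by (simp add: algebra_simps)
    qed
  qed
qed

end

section \<open>The two-node network\<close>

lemma nodes_2: "nodes 2 = {1, 2}"
proof -
  have "nodes 2 = {j. 1 \<le> j \<and> j \<le> 2}"
    by (simp only: nodes_def numeral_eq_enat enat_ord_simps)
  also have "\<dots> = {1, 2}"
    by (rule set_eqI, simp, presburger)
  finally show ?thesis .
qed

locale two_node_bass =
  bass_process 2 "\<lambda>j. p" "\<lambda>k j. if k = j then 0 else q" P X
  for p q :: real and P :: "'a measure" and X :: "nat \<Rightarrow> real \<Rightarrow> 'a \<Rightarrow> real"
begin

text \<open>While both nodes are idle neither influences the other, so each adopts at rate \<open>p\<close> only, and
  the union bound gives the matching lower estimate.\<close>
lemma idle_pair_increment_ge: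
  assumes e: "0 < \<epsilon>"
  shows "\<forall>\<^sub>F h in at_right 0. \<forall>t\<ge>0.
    (1 - (p + p) * h) * measure P (idle P X {1, 2} t) - \<epsilon> * h
      \<le> measure P (idle P X {1, 2} (t + h))"
proof -
  interpret P: prob_space P by (rule prob_space)
  have e2: "0 < \<epsilon> / 2" using e by simp
  have N: "finite (nodes 2)" "{1, 2} \<subseteq> nodes 2" "(1::nat) \<in> {1, 2}" "(2::nat) \<in> {1, 2}"
    by (auto simp: nodes_2)
  show ?thesis
    using adoption_increment_le[OF N(1,2,3) e2] adoption_increment_le[OF N(1,2,4) e2]
      eventually_at_right_less
  proof eventually_elim
    case (elim h)
    show ?case
    proof (intro allI impI)
      fix t :: real assume t: "0 \<le> t"
      let ?B = "idle P X {1, 2} t"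
      let ?E = "\<lambda>i. {\<omega> \<in> space P. X i (t + h) \<omega> = 1}"
      have B: "?B \<in> sets P" using t N by (intro idle_measurable) auto
      have E: "?E 1 \<in> sets P" "?E 2 \<in> sets P"
        using event_measurable[of "t + h"] t elim(3) N by auto
      have disj: "?B \<inter> {\<omega> \<in> space P. X k t \<omega> = 1} = {}" if "k \<in> nodes 2" for k
        using that by (auto simp: idle_def nodes_2)
      have no_peer: "(\<Sum>k\<in>nodes 2. (if k = i then 0 else q)
          * measure P (?B \<inter> {\<omega> \<in> space P. X k t \<omega> = 1})) = 0" for i
        using disj by (intro sum.neutral) auto
      have "measure P (idle P X {1, 2} (t + h)) = measure P ?B - measure P (?B \<inter> (\<Union>i\<in>{1, 2}. ?E i))"
        using t elim(3) N by (intro idle_step) auto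
      moreover have "?B \<inter> (\<Union>i\<in>{1, 2}. ?E i) = (?B \<inter> ?E 1) \<union> (?B \<inter> ?E 2)" by auto
      moreover have "measure P ((?B \<inter> ?E 1) \<union> (?B \<inter> ?E 2))
          \<le> measure P (?B \<inter> ?E 1) + measure P (?B \<inter> ?E 2)"
        using E B by (intro measure_Un_le) auto
      ultimately show "(1 - (p + p) * h) * measure P ?B - \<epsilon> * h
          \<le> measure P (idle P X {1, 2} (t + h))"
        using elim(1)[rule_format, OF t, unfolded no_peer] elim(2)[rule_format, OF t, unfolded no_peer]
        by (simp add: algebra_simps)
    qed
  qed
qed

text \<open>The only influence on \<open>i\<close> comes from the other node, which has adopted while \<open>i\<close> is idle with
  probability \<open>S\<^sub>i - S\<^bsub>{1,2}\<^esub>\<close>.\<close>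
lemma idle_single_increment_ge:
  assumes i: "i \<in> {1, 2}" and e: "0 < \<epsilon>"
  shows "\<forall>\<^sub>F h in at_right 0. \<forall>t\<ge>0.
    (1 - (p + q) * h) * measure P (idle P X {i} t)
        + q * h * measure P (idle P X {1, 2} t) - \<epsilon> * h
      \<le> measure P (idle P X {i} (t + h))"
proof -
  have N: "finite (nodes 2)" "{i} \<subseteq> nodes 2" "i \<in> {i}" using i by (auto simp: nodes_2)
  show ?thesis
    using adoption_increment_le[OF N e] eventually_at_right_less
  proof eventually_elim
    case (elim h)
    show ?case
    proof (intro allI impI)
      fix t :: real assume t: "0 \<le> t"
      let ?B = "idle P X {i} t"
      have peer: "(\<Sum>k\<in>nodes 2. (if k = i then 0 else q)
              * measure P (?B \<inter> {\<omega> \<in> space P. X k t \<omega> = 1}))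
          = q * (measure P ?B - measure P (idle P X {1, 2} t))"
        using i idle_single_diff[OF t, of 1 2] idle_single_diff[OF t, of 2 1]
        by (auto simp: nodes_2 insert_commute)
      show "(1 - (p + q) * h) * measure P ?B + q * h * measure P (idle P X {1, 2} t) - \<epsilon> * h
          \<le> measure P (idle P X {i} (t + h))"
        using elim(1)[rule_format, OF t, unfolded peer] idle_step[of t h "{i}"] t elim(2) N
        by (simp add: algebra_simps)
    qed
  qed
qed

end

section \<open>Comparison with the two-node network\<close>

lemma idle_pair_le_two_node:
  assumes N: "bass_process M p' q' P X" and T: "two_node_bass p q P2 X2"
    and p': "\<And>j. j \<in> nodes M \<Longrightarrow> p' j = p" and p: "0 \<le> p"
    and jk: "j \<in> nodes M" "k \<in> nodes M" "j \<noteq> k" and t: "0 \<le> t"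
  shows "measure P (idle P X {j, k} t) \<le> measure P2 (idle P2 X2 {1, 2} t)"
proof -
  interpret N: bass_process M p' q' P X by (rule N)
  interpret T: two_node_bass p q P2 X2 by (rule T)
  interpret P: prob_space P by (rule N.prob_space)
  interpret P2: prob_space P2 by (rule T.prob_space)
  show ?thesis
  proof (rule le_of_increment_bounds[where c = "p + p" and g = "\<lambda>_. 0"
        and u = "\<lambda>t. measure P (idle P X {j, k} t)"
        and v = "\<lambda>t. measure P2 (idle P2 X2 {1, 2} t)"])
    show "measure P (idle P X {j, k} 0) \<le> measure P2 (idle P2 X2 {1, 2} 0)"
      using jk by (simp add: N.idle_initial T.idle_initial nodes_2 P.prob_space P2.prob_space)
  qed (use N.idle_pair_increment_le[OF jk] T.idle_pair_increment_ge p' jk p t in auto)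
qed

text \<open>Bounding every pair probability of the network by the one on two nodes gives the two
  single-node inequalities the same source term.\<close>
lemma idle_single_le_two_node:
  assumes N: "bass_process M p' q' P X" and T: "two_node_bass p q P2 X2"
    and p': "\<And>j. j \<in> nodes M \<Longrightarrow> p' j = p" and p: "0 \<le> p"
    and m: "m \<in> nodes M" and q': "internal_rate M q' m = q" and q: "0 \<le> q"
    and i: "i \<in> {1, 2}" and t: "0 \<le> t"
  shows "measure P (idle P X {m} t) \<le> measure P2 (idle P2 X2 {i} t)"
proof -
  interpret N: bass_process M p' q' P X by (rule N)
  interpret T: two_node_bass p q P2 X2 by (rule T)
  interpret P: prob_space P by (rule N.prob_space)
  interpret P2: prob_space P2 by (rule T.prob_space)
  have pair: "measure P (idle P X {m, k} t) \<le> measure P2 (idle P2 X2 {1, 2} t)"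
    if "k \<in> nodes M" "k \<noteq> m" "0 \<le> t" for k t
    using idle_pair_le_two_node[OF N T p' p m that(1)] that by auto
  show ?thesis
  proof (rule le_of_increment_bounds[where c = "p + q"
        and g = "\<lambda>t. q * measure P2 (idle P2 X2 {1, 2} t)"
        and u = "\<lambda>t. measure P (idle P X {m} t)"
        and v = "\<lambda>t. measure P2 (idle P2 X2 {i} t)"])
    show "measure P (idle P X {m} 0) \<le> measure P2 (idle P2 X2 {i} 0)"
      using m i by (auto simp: N.idle_initial T.idle_initial nodes_2 P.prob_space P2.prob_space)
    fix \<epsilon> :: real assume e: "0 < \<epsilon>"
    show "\<forall>\<^sub>F h in at_right 0. \<forall>t\<ge>0. measure P (idle P X {m} (t + h))
        \<le> (1 - (p + q) * h) * measure P (idle P X {m} t)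
          + h * (q * measure P2 (idle P2 X2 {1, 2} t)) + \<epsilon> * h"
      using N.idle_single_increment_le[OF m e pair measure_nonneg] q' p'[OF m]
      by (simp add: mult_ac)
    show "\<forall>\<^sub>F h in at_right 0. \<forall>t\<ge>0. (1 - (p + q) * h) * measure P2 (idle P2 X2 {i} t)
          + h * (q * measure P2 (idle P2 X2 {1, 2} t)) - \<epsilon> * h
        \<le> measure P2 (idle P2 X2 {i} (t + h))"
      using T.idle_single_increment_ge[OF i e] by (simp add: mult_ac)
  qed (use p q t in auto)
qed

lemma adoption_level_ge:
  assumes M: "1 \<le> M" and ex: "adoption_level_exists M P X t"
    and ge: "\<And>m. m \<in> nodes M \<Longrightarrow> c \<le> adoption_prob P X m t"
  shows "c \<le> adoption_level M P X t"
proof -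
  have mean: "c \<le> mean_adoption P X t n" if "1 \<le> n" "enat n \<le> M" for n
  proof -
    have "enat j \<le> M" if "j \<le> n" for j
      using that \<open>enat n \<le> M\<close> by (meson enat_ord_simps(1) order_trans)
    then have "(\<Sum>j=1..n. c) \<le> (\<Sum>j=1..n. adoption_prob P X j t)"
      by (intro sum_mono ge) (auto simp: nodes_def)
    then show ?thesis using that by (simp add: mean_adoption_def field_simps)
  qed
  show ?thesis
  proof (cases M)
    case (enat n)
    then show ?thesis using mean[of n] M by (simp add: adoption_level_def one_enat_def)
  next
    case infinity
    then have "mean_adoption P X t \<longlonglongrightarrow> adoption_level M P X t"
      using ex by (simp add: adoption_level_def adoption_level_exists_def convergent_LIMSEQ_iff)
    then show ?thesis
      by (rule LIMSEQ_le_const) (use mean infinity in auto)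
  qed
qed

theorem theorem5:
  fixes p q :: real
    and M :: enat and p' :: "nat \<Rightarrow> real" and q' :: "nat \<Rightarrow> nat \<Rightarrow> real"
    and P :: "'a measure" and X :: "nat \<Rightarrow> real \<Rightarrow> 'a \<Rightarrow> real"
    and P2 :: "'b measure" and X2 :: "nat \<Rightarrow> real \<Rightarrow> 'b \<Rightarrow> real"
  assumes "0 < p" and "0 < q"
    and "bass_process M p' q' P X"
    and "\<forall>j\<in>nodes M. p' j = p"
    and "\<forall>j\<in>nodes M. internal_rate M q' j = q"
    and "two_node_process p q P2 X2"
  shows "(\<forall>m\<in>nodes M. \<forall>t\<ge>0. adoption_prob P X m t \<ge> adoption_level 2 P2 X2 t) \<and>
    (\<forall>t\<ge>0. adoption_level_exists M P X t \<longrightarrow>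
      adoption_level M P X t \<ge> adoption_level 2 P2 X2 t)"
proof -
  interpret N: bass_process M p' q' P X by (rule assms(3))
  have T: "two_node_bass p q P2 X2"
    using assms(6) by (simp add: two_node_process_def two_node_bass_def)
  interpret T: two_node_bass p q P2 X2 by (rule T)
  have single: "adoption_prob P2 X2 i t \<le> adoption_prob P X m t"
    if "m \<in> nodes M" "0 \<le> t" "i \<in> {1, 2}" for m i t
    using idle_single_le_two_node[OF assms(3) T _ _ that(1) _ _ that(3,2)] that assms(1,2,4,5)
    by (simp add: N.adoption_prob_eq T.adoption_prob_eq nodes_2)
  have level2: "adoption_level 2 P2 X2 t = (adoption_prob P2 X2 1 t + adoption_prob P2 X2 2 t) / 2"
    for t
  proof -
    have "{1..2 :: nat} = {1, 2}" by auto
    then have "mean_adoption P2 X2 t 2 = (adoption_prob P2 X2 1 t + adoption_prob P2 X2 2 t) / 2"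
      by (simp add: mean_adoption_def)
    then show ?thesis by (simp only: adoption_level_def numeral_eq_enat enat.case)
  qed
  have node: "adoption_level 2 P2 X2 t \<le> adoption_prob P X m t" if "m \<in> nodes M" "0 \<le> t" for m t
    using single[OF that, of 1] single[OF that, of 2] by (simp add: level2)
  then show ?thesis
    using adoption_level_ge[OF N.nodes_nonempty] by blast
qed

end
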